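(* For all integers $n\ge0$ and $r\ge m\ge0$, $$\sum_{k=0}^{n}\left(-\frac14\right)^k\binom{n+r-m}{n-k}\binom{2r+2k}{r+k}\binom{r-m+k}{k}=4^{-n}\binom{n+r}{m}^{-1}\binom{r}{m}\binom{2r}{r}\binom{2n}{n}.$$ *)

theory Defs
  imports Complex_Main
begin

end

theory Submission
  imports Defs
begin

text \<open>
  Put \<open>s = r - m\<close>. Trinomial revision turns \<open>(n + s choose n - k) (s + k choose k)\<close> into
  \<open>(n + s choose n) (n choose k)\<close>, so that \<open>s\<close> leaves the sum and what remains is an \<open>n\<close>-th finite
  difference of the central binomial coefficients, scaled by powers of \<open>-1/4\<close>:
  \<open>T n r = (\<Sum>k\<le>n. (n choose k) (-1/4) ^ k (2 (r + k) choose r + k))\<close>.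
  Pascal's rule gives \<open>T (n + 1) r = T n r - T n (r + 1) / 4\<close>.
  The super Catalan numbers \<open>S r n = (2 r)! (2 n)! / (r! n! (r + n)!)\<close> satisfy
  \<open>S (r + 1) n + S r (n + 1) = 4 S r n\<close> and \<open>S r 0 = (2 r choose r)\<close>, which makes
  \<open>S r n / 4 ^ n\<close> a solution of the same recurrence with the same initial values; hence
  \<open>T n r = S r n / 4 ^ n\<close>. Expanding the binomial coefficients into factorials then yields the
  stated product.

  Analytically, \<open>(2 j choose j) / 4 ^ j\<close> is the \<open>j\<close>-th moment of the arcsine law on \<open>[0, 1]\<close>,
  and \<open>T n r / 4 ^ r\<close> is the integral of \<open>x ^ r (1 - x) ^ n\<close> against it, a beta integral.
\<close>

definition super_catalan :: "nat \<Rightarrow> nat \<Rightarrow> real" where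
  "super_catalan r n = fact (2 * r) * fact (2 * n) / (fact r * fact n * fact (r + n))"

lemma super_catalan_0_right: "super_catalan r 0 = real ((2 * r) choose r)"
  by (simp add: super_catalan_def binomial_fact)

lemma super_catalan_Suc_left:
  "super_catalan (Suc r) n = 2 * (2 * real r + 1) / (real r + real n + 1) * super_catalan r n"
proof -
  have "fact (2 * Suc r) = (2 * (real r + 1)) * (2 * real r + 1) * fact (2 * r)"
    by (simp add: algebra_simps)
  then show ?thesis
    by (simp add: super_catalan_def divide_simps del: of_nat_Suc) (simp add: algebra_simps)
qed

lemma super_catalan_commute: "super_catalan r n = super_catalan n r"
  by (simp add: super_catalan_def ac_simps)

text \<open>
  The two ratios of neighbouring values are \<open>2 (2 r + 1) / (r + n + 1)\<close> and
  \<open>2 (2 n + 1) / (r + n + 1)\<close>, and these add up to 4.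
\<close>

lemma super_catalan_recurrence:
  "super_catalan (Suc r) n + super_catalan r (Suc n) = 4 * super_catalan r n"
proof -
  have ratios: "2 * (2 * real r + 1) / (real r + real n + 1)
      + 2 * (2 * real n + 1) / (real r + real n + 1) = 4"
    unfolding add_divide_distrib[symmetric] by (simp add: divide_eq_eq)
  have "super_catalan r (Suc n)
      = 2 * (2 * real n + 1) / (real r + real n + 1) * super_catalan r n"
    using super_catalan_Suc_left[of n r]
    by (simp only: super_catalan_commute[of _ r] add.commute[of "real n" "real r"])
  then have "super_catalan (Suc r) n + super_catalan r (Suc n)
      = (2 * (2 * real r + 1) / (real r + real n + 1)
          + 2 * (2 * real n + 1) / (real r + real n + 1)) * super_catalan r n"
    by (simp only: super_catalan_Suc_left distrib_right)
  then show ?thesis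
    by (simp only: ratios)
qed

lemma sum_binomial_Suc:
  fixes f :: "nat \<Rightarrow> 'a::comm_semiring_1"
  shows "(\<Sum>k\<le>Suc n. of_nat (Suc n choose k) * f k)
       = (\<Sum>k\<le>n. of_nat (n choose k) * f k) + (\<Sum>k\<le>n. of_nat (n choose k) * f (Suc k))"
proof -
  have "(\<Sum>k\<le>Suc n. of_nat (Suc n choose k) * f k)
      = f 0 + (\<Sum>k\<le>n. of_nat (n choose Suc k) * f (Suc k))
        + (\<Sum>k\<le>n. of_nat (n choose k) * f (Suc k))"
    by (simp add: sum.atMost_Suc_shift sum.distrib algebra_simps del: sum.atMost_Suc)
  also have "f 0 + (\<Sum>k\<le>n. of_nat (n choose Suc k) * f (Suc k))
      = (\<Sum>k\<le>Suc n. of_nat (n choose k) * f k)"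
    by (simp add: sum.atMost_Suc_shift del: sum.atMost_Suc)
  also have "\<dots> = (\<Sum>k\<le>n. of_nat (n choose k) * f k)"
    by (simp add: binomial_eq_0)
  finally show ?thesis .
qed

text \<open>
  The induction on \<open>n\<close> needs \<open>r\<close> arbitrary, because the step refers to both \<open>r\<close> and \<open>Suc r\<close>.
\<close>

lemma sum_central_binomial_difference:
  "(\<Sum>k\<le>n. real (n choose k) * ((- (1 / 4)) ^ k * real ((2 * (r + k)) choose (r + k))))
     = (1 / 4) ^ n * super_catalan r n"
proof (induction n arbitrary: r)
  case 0
  show ?case
    by (simp add: super_catalan_0_right)
next
  case (Suc n)
  let ?f = "\<lambda>r k. (- (1 / 4 :: real)) ^ k * real ((2 * (r + k)) choose (r + k))"
  have shift: "?f r (Suc k) = - (1 / 4) * ?f (Suc r) k" for k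
    by simp
  have "(\<Sum>k\<le>Suc n. real (Suc n choose k) * ?f r k)
      = (\<Sum>k\<le>n. real (n choose k) * ?f r k) + (\<Sum>k\<le>n. real (n choose k) * ?f r (Suc k))"
    by (rule sum_binomial_Suc)
  also have "(\<Sum>k\<le>n. real (n choose k) * ?f r (Suc k))
      = - (1 / 4) * (\<Sum>k\<le>n. real (n choose k) * ?f (Suc r) k)"
    unfolding shift sum_distrib_left by (simp only: ac_simps)
  also have "(\<Sum>k\<le>n. real (n choose k) * ?f r k)
        + - (1 / 4) * (\<Sum>k\<le>n. real (n choose k) * ?f (Suc r) k)
      = (1 / 4) ^ n * super_catalan r n - (1 / 4) * ((1 / 4) ^ n * super_catalan (Suc r) n)"
    by (simp only: Suc.IH mult_minus_left diff_conv_add_uminus)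
  also have "\<dots> = (1 / 4) ^ Suc n * (4 * super_catalan r n - super_catalan (Suc r) n)"
    by (simp add: algebra_simps)
  also have "4 * super_catalan r n - super_catalan (Suc r) n = super_catalan r (Suc n)"
    using super_catalan_recurrence[of r n] by simp
  finally show ?case .
qed

lemma choose_mult_choose_add:
  fixes n s k :: nat
  assumes "k \<le> n"
  shows "((n + s) choose (n - k)) * ((s + k) choose k) = ((n + s) choose n) * (n choose k)"
proof -
  have "n + s - k - (n - k) = s" and "n + s - (n - k) = s + k"
    using assms by auto
  then have "real ((n + s) choose (n - k)) * real ((s + k) choose k)
      = real ((n + s) choose n) * real (n choose k)"
    using assms by (simp add: binomial_fact)
  then show ?thesis
    by (metis of_nat_eq_iff of_nat_mult)
qed

theorem mainTheorem15:
  fixes n r m :: nat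
  assumes "m \<le> r"
  shows "(\<Sum>k=0..n. (- (1 / 4 :: real)) ^ k * real ((n + r - m) choose (n - k))
            * real ((2 * r + 2 * k) choose (r + k)) * real ((r - m + k) choose k))
       = (1 / 4) ^ n * inverse (real ((n + r) choose m))
            * real (r choose m) * real ((2 * r) choose r) * real ((2 * n) choose n)"
proof -
  define s where "s = r - m"
  have r: "r = s + m"
    using assms by (simp add: s_def)
  have summand: "(- (1 / 4 :: real)) ^ k * real ((n + r - m) choose (n - k))
        * real ((2 * r + 2 * k) choose (r + k)) * real ((r - m + k) choose k)
      = real ((n + s) choose n)
        * (real (n choose k) * ((- (1 / 4)) ^ k * real ((2 * (r + k)) choose (r + k))))"
    if "k \<le> n" for k
  proof -
    have args: "n + r - m = n + s" "r - m + k = s + k" "2 * r + 2 * k = 2 * (r + k)"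
      using r by auto
    have rearrange: "x * a * y * b = (a * b) * (x * y)" for x a y b :: real
      by (simp only: ac_simps)
    show ?thesis
      unfolding args rearrange of_nat_mult[symmetric] choose_mult_choose_add[OF that]
      by (simp only: of_nat_mult mult.assoc)
  qed
  have "(\<Sum>k=0..n. (- (1 / 4 :: real)) ^ k * real ((n + r - m) choose (n - k))
            * real ((2 * r + 2 * k) choose (r + k)) * real ((r - m + k) choose k))
      = real ((n + s) choose n) * (\<Sum>k\<le>n. real (n choose k)
          * ((- (1 / 4)) ^ k * real ((2 * (r + k)) choose (r + k))))"
    unfolding atLeast0AtMost sum_distrib_left by (intro sum.cong refl summand) simp
  also have "\<dots> = (1 / 4) ^ n * (real ((n + s) choose n) * super_catalan r n)"
    by (simp only: sum_central_binomial_difference mult.left_commute)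
  also have "real ((n + s) choose n) * super_catalan r n
      = inverse (real ((n + r) choose m)) * real (r choose m)
          * real ((2 * r) choose r) * real ((2 * n) choose n)"
  proof -
    have "real ((n + s) choose n) = fact (n + s) / (fact n * fact s)"
      using binomial_fact[of n "n + s"] by simp
    moreover have "real ((n + r) choose m) = fact (r + n) / (fact m * fact (n + s))"
      using binomial_fact[of m "n + r"] by (simp add: r ac_simps)
    moreover have "real (r choose m) = fact r / (fact m * fact s)"
      using binomial_fact[of m r] by (simp add: r)
    moreover have "real ((2 * r) choose r) = fact (2 * r) / (fact r * fact r)"
      using binomial_fact[of r "2 * r"] by simp
    moreover have "real ((2 * n) choose n) = fact (2 * n) / (fact n * fact n)"
      using binomial_fact[of n "2 * n"] by simp
    ultimately show ?thesis
      by (simp only: super_catalan_def) (simp add: field_simps)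
  qed
  finally show ?thesis
    by (simp only: mult.assoc)
qed

end
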